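(* We have $$\lim_{n\to\infty}\frac{\log|M_n|}{\log|\mathrm{Aut}(\mathcal T_n)|}=1-\frac{1}{3\log_2 6}\approx 0.871,$$ and the same limit holds with $M_n$ replaced by $H_n$, by $K_n$, or by $\langle K_n,y_n\rangle$.
   Context: Let $X=\{0,1,2\}$ and let $\mathcal T$ be the rooted ternary tree whose vertices are the finite words over $X$ (the children of $w$ are $w0,w1,w2$); $\mathcal T_n$ is the tree truncated at level $n$, with $\mathrm{Aut}(\mathcal T_1)=S_3$. Automorphisms act on the right, written $(w)\sigma$, and $\sigma\tau$ means first $\sigma$ then $\tau$. For $n\ge2$ every $\sigma\in\mathrm{Aut}(\mathcal T_n)$ is written uniquely as $\sigma=(\sigma_0,\sigma_1,\sigma_2)\pi$ with $\pi\in S_3$, $\sigma_i\in\mathrm{Aut}(\mathcal T_{n-1})$, meaning $(iw)\sigma=((i)\pi)((w)\sigma_i)$; hence $(\sigma_0,\sigma_1,\sigma_2)\pi\cdot(\tau_0,\tau_1,\tau_2)\rho=(\sigma_0\tau_{(0)\pi},\sigma_1\tau_{(1)\pi},\sigma_2\tau_{(2)\pi})\pi\rho$; write $(\sigma_0,\sigma_1,\sigma_2)$ when $\pi=\mathrm{id}$. $\mathrm{Aut}(\mathcal T_{n-1})$ is embedded in $\mathrm{Aut}(\mathcal T_n)$ via $\sigma\mapsto(\sigma,\mathrm{id},\mathrm{id})$. Define $x_1=(0,1,2)$, $y_1=(0,1)$, $z_1=\mathrm{id}$, and for $n\ge2$: $x_n=(\mathrm{id},\mathrm{id},x_{n-1})(0,1,2)$,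 $y_n=(\mathrm{id},y_{n-1},x_{n-1})(0,1)$, $z_n=(y_{n-1},y_{n-1},x_{n-1})$. Let $L_1=\langle x_1\rangle$, $M_1=S_3$, and for $n\ge2$: $L_n=\langle x_n,z_n,L_{n-1}\rangle$, $M_n=\langle x_n,y_n,z_n,L_{n-1}\rangle\le\mathrm{Aut}(\mathcal T_n)$. $H_n$ is the normal closure of $L_{n-1}$ in $L_n$, and $K_n$ is the normal closure in $L_n$ of $\langle H_n,z_n\rangle$. (This limit is the Hausdorff dimension of the corresponding profinite group in $\mathrm{Aut}(\mathcal T)$.) *)

theory Defs
  imports
    "HOL-Analysis.Analysis"
    "HOL-Algebra.Generated_Groups"
    "HOL-Combinatorics.Cycles"
begin

type_synonym word = "nat list"

definition words :: "nat \<Rightarrow> word set" where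
  "words n = {w. set w \<subseteq> {0, 1, 2} \<and> length w \<le> n}"

definition is_child :: "word \<Rightarrow> word \<Rightarrow> bool" where
  "is_child w v \<longleftrightarrow> (\<exists>i. v = w @ [i])"

text \<open>Automorphisms of the truncated tree are extended by the identity to all lists, as
  built into \<^const>\<open>permutes\<close>, so that they form a set of functions of the right cardinality.\<close>

definition tree_auts :: "nat \<Rightarrow> (word \<Rightarrow> word) set" where
  "tree_auts n = {\<sigma>. \<sigma> permutes words n \<and> \<sigma> [] = [] \<and>
     (\<forall>w\<in>words n. \<forall>v\<in>words n. is_child (\<sigma> w) (\<sigma> v) \<longleftrightarrow> is_child w v)}"

text \<open>Automorphisms act on the right, so the product of \<open>\<sigma>\<close> and \<open>\<tau>\<close> is \<open>\<tau> \<circ> \<sigma>\<close>.\<close>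

definition Aut_tree :: "nat \<Rightarrow> (word \<Rightarrow> word) monoid" where
  "Aut_tree n = \<lparr>carrier = tree_auts n, mult = (\<lambda>\<sigma> \<tau>. \<tau> \<circ> \<sigma>), one = id\<rparr>"

text \<open>The element \<open>(\<sigma>\<^sub>0, \<sigma>\<^sub>1, \<sigma>\<^sub>2) \<pi>\<close> of the automorphism group of the tree truncated at level \<open>n\<close>,
  sending \<open>i w\<close> to \<open>(i)\<pi> (w)\<sigma>\<^sub>i\<close>.\<close>

definition wreath ::
  "nat \<Rightarrow> (word \<Rightarrow> word) \<Rightarrow> (word \<Rightarrow> word) \<Rightarrow> (word \<Rightarrow> word) \<Rightarrow> (nat \<Rightarrow> nat) \<Rightarrow> word \<Rightarrow> word" where
  "wreath n \<sigma>0 \<sigma>1 \<sigma>2 \<pi> w =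
     (if w \<in> words n \<and> w \<noteq> [] then \<pi> (hd w) # ([\<sigma>0, \<sigma>1, \<sigma>2] ! hd w) (tl w) else w)"

definition embed :: "nat \<Rightarrow> (word \<Rightarrow> word) \<Rightarrow> word \<Rightarrow> word" where
  "embed n \<sigma> = wreath n \<sigma> id id id"

text \<open>The sequences below start at index \<open>1\<close>; the values at \<open>0\<close> are fillers.
  The groups \<open>H\<close> and \<open>K\<close> are meaningful from index \<open>2\<close> on.\<close>

fun x_gen :: "nat \<Rightarrow> word \<Rightarrow> word" where
  "x_gen 0 = id"
| "x_gen (Suc 0) = wreath 1 id id id (cycle_of_list [0, 1, 2])"
| "x_gen (Suc (Suc n)) =
     wreath (Suc (Suc n)) id id (x_gen (Suc n)) (cycle_of_list [0, 1, 2])"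

fun y_gen :: "nat \<Rightarrow> word \<Rightarrow> word" where
  "y_gen 0 = id"
| "y_gen (Suc 0) = wreath 1 id id id (cycle_of_list [0, 1])"
| "y_gen (Suc (Suc n)) =
     wreath (Suc (Suc n)) id (y_gen (Suc n)) (x_gen (Suc n)) (cycle_of_list [0, 1])"

fun z_gen :: "nat \<Rightarrow> word \<Rightarrow> word" where
  "z_gen 0 = id"
| "z_gen (Suc 0) = id"
| "z_gen (Suc (Suc n)) =
     wreath (Suc (Suc n)) (y_gen (Suc n)) (y_gen (Suc n)) (x_gen (Suc n)) id"

fun L_grp :: "nat \<Rightarrow> (word \<Rightarrow> word) set" where
  "L_grp 0 = {id}"
| "L_grp (Suc 0) = generate (Aut_tree 1) {x_gen 1}"
| "L_grp (Suc (Suc n)) = generate (Aut_tree (Suc (Suc n)))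
     ({x_gen (Suc (Suc n)), z_gen (Suc (Suc n))} \<union> embed (Suc (Suc n)) ` L_grp (Suc n))"

fun M_grp :: "nat \<Rightarrow> (word \<Rightarrow> word) set" where
  "M_grp 0 = {id}"
| "M_grp (Suc 0) = carrier (Aut_tree 1)"
| "M_grp (Suc (Suc n)) = generate (Aut_tree (Suc (Suc n)))
     ({x_gen (Suc (Suc n)), y_gen (Suc (Suc n)), z_gen (Suc (Suc n))}
       \<union> embed (Suc (Suc n)) ` L_grp (Suc n))"

definition normal_closure :: "('a, 'b) monoid_scheme \<Rightarrow> 'a set \<Rightarrow> 'a set" where
  "normal_closure G S = \<Inter>{N. N \<lhd> G \<and> S \<subseteq> N}"

abbreviation L_group :: "nat \<Rightarrow> (word \<Rightarrow> word) monoid" where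
  "L_group n \<equiv> (Aut_tree n)\<lparr>carrier := L_grp n\<rparr>"

definition H_grp :: "nat \<Rightarrow> (word \<Rightarrow> word) set" where
  "H_grp n = normal_closure (L_group n) (embed n ` L_grp (n - 1))"

definition K_grp :: "nat \<Rightarrow> (word \<Rightarrow> word) set" where
  "K_grp n = normal_closure (L_group n) (generate (Aut_tree n) (H_grp n \<union> {z_gen n}))"

definition log_density :: "(nat \<Rightarrow> (word \<Rightarrow> word) set) \<Rightarrow> nat \<Rightarrow> real" where
  "log_density G n = ln (real (card (G n))) / ln (real (card (carrier (Aut_tree n))))"

end

theory Submission
  imports Defs
begin

text \<open>
  Let \<open>P\<^sub>1 = Aut(T\<^sub>1)\<close> and let \<open>P\<^sub>n\<close> consist of the \<open>(\<sigma>\<^sub>0, \<sigma>\<^sub>1, \<sigma>\<^sub>2)\<pi>\<close> with all \<open>\<sigma>\<^sub>i \<in> P\<^sub>n\<^sub>-\<^sub>1\<close> such that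
  the sign of \<open>\<pi>\<close> is the product of the signs of the root permutations of the \<open>\<sigma>\<^sub>i\<close>. Since
  \<open>\<sigma>\<^sub>0, \<sigma>\<^sub>1, \<sigma>\<^sub>2\<close> determine the sign of \<open>\<pi>\<close>, this is a group with \<open>|P\<^sub>n| = 3 |P\<^sub>n\<^sub>-\<^sub>1|\<^sup>3\<close>, while
  \<open>|Aut(T\<^sub>n)| = 6 |Aut(T\<^sub>n\<^sub>-\<^sub>1)|\<^sup>3\<close>; the quotient of the logarithms therefore tends to the claimed
  value. All generators lie in \<open>P\<^sub>n\<close>, so \<open>M\<^sub>n \<le> P\<^sub>n\<close>. By induction \<open>L\<^sub>n\<close> is the subgroup of index
  two of \<open>P\<^sub>n\<close> where the root permutation is even. Conjugation by \<open>x\<^sub>n\<close> moves the first factor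
  \<open>L\<^sub>n\<^sub>-\<^sub>1\<close> to the other two, so \<open>H\<^sub>n\<close> contains the cube of \<open>L\<^sub>n\<^sub>-\<^sub>1\<close>, which has index 24
  in \<open>P\<^sub>n\<close>. All groups in question lie between this cube and \<open>P\<^sub>n\<close>.
\<close>

subsection \<open>Wreath decomposition of tree automorphisms\<close>

definition letters :: "nat set" where "letters = {0, 1, 2}"

lemma finite_letters [simp]: "finite letters"
  and card_letters [simp]: "card letters = 3"
  by (simp_all add: letters_def)

text \<open>The product \<open>(f 0, f 1, f 2) \<pi>\<close>; the values of \<open>f\<close> outside \<open>letters\<close> are irrelevant.\<close>

definition branch :: "nat \<Rightarrow> (nat \<Rightarrow> word \<Rightarrow> word) \<Rightarrow> (nat \<Rightarrow> nat) \<Rightarrow> word \<Rightarrow> word" where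
  "branch n f \<pi> w = (if w \<in> words n \<and> w \<noteq> [] then \<pi> (hd w) # f (hd w) (tl w) else w)"

lemma wreath_eq_branch: "wreath n a b c \<pi> = branch n ((!) [a, b, c]) \<pi>"
  by (simp add: fun_eq_iff wreath_def branch_def)

lemma Nil_in_words [simp]: "[] \<in> words n"
  by (simp add: words_def)

lemma Cons_in_words_Suc: "i # w \<in> words (Suc n) \<longleftrightarrow> i \<in> letters \<and> w \<in> words n"
  by (auto simp: words_def letters_def)

lemma finite_words: "finite (words n)"
  unfolding words_def by (rule finite_lists_length_le) simp

lemma branch_Nil [simp]: "branch n f \<pi> [] = []"
  by (simp add: branch_def)

lemma branch_Cons:
  assumes "i \<in> letters" "w \<in> words n"
  shows "branch (Suc n) f \<pi> (i # w) = \<pi> i # f i w"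
  using assms by (simp add: branch_def Cons_in_words_Suc)

lemma branch_outside: "w \<notin> words n \<Longrightarrow> branch n f \<pi> w = w"
  by (simp add: branch_def)

lemma branch_cong:
  assumes "\<And>i. i \<in> letters \<Longrightarrow> f i = g i" "\<And>i. i \<in> letters \<Longrightarrow> \<pi> i = \<rho> i"
  shows "branch n f \<pi> = branch n g \<rho>"
proof
  fix w show "branch n f \<pi> w = branch n g \<rho> w"
    using assms[of "hd w"] by (cases w) (auto simp: branch_def words_def letters_def)
qed

lemma branch_id: "(\<And>i. i \<in> letters \<Longrightarrow> f i = id) \<Longrightarrow> branch n f id = id"
proof
  fix w assume "\<And>i. i \<in> letters \<Longrightarrow> f i = id"
  then show "branch n f id w = id w"
    by (cases w) (auto simp: branch_def words_def letters_def)
qed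

section \<open>The group of automorphisms of the truncated tree\<close>

lemma tree_autsD:
  assumes "\<sigma> \<in> tree_auts n"
  shows "\<sigma> permutes words n" "\<sigma> [] = []"
    "\<And>w v. w \<in> words n \<Longrightarrow> v \<in> words n \<Longrightarrow> is_child (\<sigma> w) (\<sigma> v) \<longleftrightarrow> is_child w v"
  using assms by (auto simp: tree_auts_def)

lemma tree_auts_words: "\<sigma> \<in> tree_auts n \<Longrightarrow> \<sigma> w \<in> words n \<longleftrightarrow> w \<in> words n"
  by (auto dest: tree_autsD(1) simp: permutes_in_image)

lemma id_in_tree_auts: "id \<in> tree_auts n"
  by (simp add: tree_auts_def permutes_id)

lemma comp_in_tree_auts:
  assumes "\<sigma> \<in> tree_auts n" "\<tau> \<in> tree_auts n"
  shows "\<tau> \<circ> \<sigma> \<in> tree_auts n"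
  using assms tree_auts_words[OF assms(1)]
  by (auto simp: tree_auts_def intro: permutes_compose)

lemma inv_in_tree_auts:
  assumes "\<sigma> \<in> tree_auts n"
  shows "inv_into UNIV \<sigma> \<in> tree_auts n"
proof -
  note p = tree_autsD[OF assms]
  have q: "inv_into UNIV \<sigma> permutes words n" using p(1) by (rule permutes_inv)
  have "is_child (inv_into UNIV \<sigma> w) (inv_into UNIV \<sigma> v) \<longleftrightarrow> is_child w v"
    if "w \<in> words n" "v \<in> words n" for w v
    using p(3)[of "inv_into UNIV \<sigma> w" "inv_into UNIV \<sigma> v"] that
    by (simp add: permutes_in_image[OF q] permutes_inverses[OF p(1)])
  moreover have "inv_into UNIV \<sigma> [] = []"
    using p(2) permutes_inverses(2)[OF p(1)] by metis
  ultimately show ?thesis using q by (simp add: tree_auts_def)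
qed

lemma carrier_Aut_tree [simp]: "carrier (Aut_tree n) = tree_auts n"
  and mult_Aut_tree [simp]: "\<sigma> \<otimes>\<^bsub>Aut_tree n\<^esub> \<tau> = \<tau> \<circ> \<sigma>"
  and one_Aut_tree [simp]: "\<one>\<^bsub>Aut_tree n\<^esub> = id"
  by (simp_all add: Aut_tree_def)

lemma group_Aut_tree: "group (Aut_tree n)"
proof (rule groupI)
  fix \<sigma> assume "\<sigma> \<in> carrier (Aut_tree n)"
  then have s: "\<sigma> \<in> tree_auts n" by simp
  show "\<exists>\<tau>\<in>carrier (Aut_tree n). \<tau> \<otimes>\<^bsub>Aut_tree n\<^esub> \<sigma> = \<one>\<^bsub>Aut_tree n\<^esub>"
    using inv_in_tree_auts[OF s] permutes_inv_o(1)[OF tree_autsD(1)[OF s]] by auto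
qed (auto simp: id_in_tree_auts comp_in_tree_auts o_assoc)

text \<open>The product rule of the wreath recursion in composition order: the inner factor moves
  letter \<open>i\<close> to \<open>\<pi> i\<close> first, so the outer section is the one at
  \<open>\<pi> i\<close>. The hypotheses keep the intermediate word inside the tree, where the outer
  \<open>branch\<close> follows its recursion.\<close>

lemma branch_comp:
  assumes "\<And>i. i \<in> letters \<Longrightarrow> f i \<in> tree_auts n" "\<pi> permutes letters"
  shows "branch (Suc n) g \<rho> \<circ> branch (Suc n) f \<pi>
    = branch (Suc n) (\<lambda>i. g (\<pi> i) \<circ> f i) (\<rho> \<circ> \<pi>)"
proof
  fix w
  show "(branch (Suc n) g \<rho> \<circ> branch (Suc n) f \<pi>) w
    = branch (Suc n) (\<lambda>i. g (\<pi> i) \<circ> f i) (\<rho> \<circ> \<pi>) w"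
  proof (cases "w \<in> words (Suc n) \<and> w \<noteq> []")
    case True
    then obtain i v where w: "w = i # v" "i \<in> letters" "v \<in> words n"
      by (cases w) (auto simp: Cons_in_words_Suc)
    have "\<pi> i \<in> letters" "f i v \<in> words n"
      using w assms(1) tree_auts_words permutes_in_image[OF assms(2)] by blast+
    then show ?thesis by (simp only: w o_apply branch_Cons)
  qed (auto simp: branch_def)
qed

lemma branch_triple_comp:
  assumes "a \<in> tree_auts n" "b \<in> tree_auts n" "c \<in> tree_auts n"
  shows "branch (Suc n) ((!) [a', b', c']) id \<circ> branch (Suc n) ((!) [a, b, c]) id
    = branch (Suc n) ((!) [a' \<circ> a, b' \<circ> b, c' \<circ> c]) id"
  by (subst branch_comp; (intro branch_cong)?)
    (use assms in \<open>auto simp: letters_def permutes_id\<close>)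

text \<open>Bijectivity comes from an explicit two-sided inverse of the same \<open>branch\<close>
  form. The child relation is checked by comparing first letters and then passing to a single
  section.\<close>

lemma branch_in_tree_auts:
  assumes f: "\<And>i. i \<in> letters \<Longrightarrow> f i \<in> tree_auts n" and p: "\<pi> permutes letters"
  shows "branch (Suc n) f \<pi> \<in> tree_auts (Suc n)"
proof -
  \<comment> \<open>The section of the inverse at \<open>i\<close> has to undo the section that led
    to \<open>i\<close>, which sits at the preimage \<open>q i\<close>.\<close>
  define q where "q = inv_into UNIV \<pi>"
  define g where "g = (\<lambda>i. inv_into UNIV (f (q i)))"
  have q: "q permutes letters" unfolding q_def using p by (rule permutes_inv)
  have pX: "\<pi> i \<in> letters \<longleftrightarrow> i \<in> letters" and qX: "q i \<in> letters \<longleftrightarrow> i \<in> letters" for i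
    using permutes_in_image[OF p] permutes_in_image[OF q] by auto
  have pq: "\<pi> \<circ> q = id" "q \<circ> \<pi> = id"
    unfolding q_def using permutes_inv_o[OF p] by auto
  have g: "g i \<in> tree_auts n" if "i \<in> letters" for i
    unfolding g_def using that qX f inv_in_tree_auts by blast
  have fw: "f i w \<in> words n \<longleftrightarrow> w \<in> words n" if "i \<in> letters" for i w
    using tree_auts_words[OF f[OF that]] .
  let ?B = "branch (Suc n) f \<pi>" and ?C = "branch (Suc n) g q"
  have "?B \<circ> ?C = branch (Suc n) (\<lambda>i. f (q i) \<circ> g i) id"
    by (subst branch_comp[OF g q]) (simp_all add: pq)
  also have "\<dots> = id"
    unfolding g_def using permutes_inv_o(1)[OF tree_autsD(1)[OF f]] qX
    by (intro branch_id) simp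
  finally have BC: "?B \<circ> ?C = id" .
  have "?C \<circ> ?B = branch (Suc n) (\<lambda>i. g (\<pi> i) \<circ> f i) id"
    by (subst branch_comp[OF f p]) (simp_all add: pq)
  also have "\<dots> = id"
    unfolding g_def using permutes_inv_o(2)[OF tree_autsD(1)[OF f]] fun_cong[OF pq(2)]
    by (intro branch_id) simp
  finally have CB: "?C \<circ> ?B = id" .
  have "bij ?B" using BC CB o_bij by blast
  then have B: "?B permutes words (Suc n)"
    using branch_outside by (auto simp: permutes_def bij_iff)
  have "is_child (?B w) (?B v) \<longleftrightarrow> is_child w v"
    if wv: "w \<in> words (Suc n)" "v \<in> words (Suc n)" for w v
  proof (cases v)
    case Nil
    then show ?thesis by (simp add: is_child_def)
  next
    case v: (Cons j v')
    then have j: "j \<in> letters" "v' \<in> words n" using wv by (auto simp: Cons_in_words_Suc)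
    have Bv: "?B v = \<pi> j # f j v'" using j v branch_Cons by blast
    have fj: "f j [] = []" "inj (f j)"
      using tree_autsD[OF f[OF j(1)]] permutes_inj by auto
    show ?thesis
    proof (cases w)
      case Nil
      have "f j v' = [] \<longleftrightarrow> v' = []" using fj(1) inj_eq[OF fj(2), of v' "[]"] by simp
      then show ?thesis unfolding Bv by (simp add: Nil v is_child_def)
    next
      case w: (Cons i w')
      then have i: "i \<in> letters" "w' \<in> words n" using wv by (auto simp: Cons_in_words_Suc)
      have Bw: "?B w = \<pi> i # f i w'" using i w branch_Cons by blast
      have "is_child (?B w) (?B v) \<longleftrightarrow> \<pi> i = \<pi> j \<and> is_child (f i w') (f j v')"
        unfolding Bv Bw is_child_def by auto
      also have "\<dots> \<longleftrightarrow> i = j \<and> is_child (f j w') (f j v')"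
        using permutes_inj[OF p] by (auto dest: injD)
      also have "\<dots> \<longleftrightarrow> i = j \<and> is_child w' v'"
        using tree_autsD(3)[OF f[OF j(1)] i(2) j(2)] by simp
      also have "\<dots> \<longleftrightarrow> is_child w v" unfolding v w is_child_def by auto
      finally show ?thesis .
    qed
  qed
  then show ?thesis using B by (simp add: tree_auts_def)
qed

text \<open>Automorphisms preserve prefixes, because each letter appended on the right is one child
  step. This is what makes the root permutation and the sections well defined.\<close>

lemma tree_auts_append:
  assumes s: "\<sigma> \<in> tree_auts n" and "w @ v \<in> words n"
  shows "\<exists>u. \<sigma> (w @ v) = \<sigma> w @ u \<and> length u = length v"
  using assms(2)
proof (induction v rule: rev_induct)
  case (snoc i v)
  then have in_words: "w @ v \<in> words n" by (auto simp: words_def)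
  then obtain u where u: "\<sigma> (w @ v) = \<sigma> w @ u" "length u = length v" using snoc by auto
  have "is_child (\<sigma> (w @ v)) (\<sigma> (w @ v @ [i]))"
    using tree_autsD(3)[OF s in_words snoc.prems] by (simp add: is_child_def)
  then show ?case using u by (auto simp: is_child_def)
qed simp

text \<open>The root permutation is the action on words of length one, and a section is what remains
  after deleting the first letter of the image. On these finite sets injectivity already gives
  bijectivity.\<close>

lemma tree_auts_Suc_branchE:
  assumes s: "\<sigma> \<in> tree_auts (Suc n)"
  obtains f \<pi> where "\<And>i. i \<in> letters \<Longrightarrow> f i \<in> tree_auts n" "\<pi> permutes letters" "\<sigma> = branch (Suc n) f \<pi>"
proof
  \<comment> \<open>Off the letters and off the tree both maps are the identity, as
    \<open>permutes\<close> demands.\<close>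
  define \<pi> where "\<pi> = (\<lambda>i. if i \<in> letters then hd (\<sigma> [i]) else i)"
  define f where "f = (\<lambda>i w. if w \<in> words n then tl (\<sigma> (i # w)) else w)"
  note sD = tree_autsD[OF s]
  have s1: "\<sigma> [i] = [\<pi> i]" if "i \<in> letters" for i
    using tree_auts_append[OF s, of "[]" "[i]"] that sD(2)
    by (auto simp: \<pi>_def words_def letters_def length_Suc_conv)
  have sw: "\<sigma> (i # w) = \<pi> i # f i w" if "i \<in> letters" "w \<in> words n" for i w
    using tree_auts_append[OF s, of "[i]" w] that s1 by (auto simp: Cons_in_words_Suc f_def)
  have in_words: "\<pi> i \<in> letters \<and> f i w \<in> words n" if "i \<in> letters" "w \<in> words n" for i w
    using tree_auts_words[OF s, of "i # w"] sw[OF that] that by (simp add: Cons_in_words_Suc)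
  have inj: "inj \<sigma>" using sD(1) by (rule permutes_inj)
  have "inj_on \<pi> letters"
  proof (rule inj_onI)
    fix i j assume "i \<in> letters" "j \<in> letters" "\<pi> i = \<pi> j"
    then have "\<sigma> [i] = \<sigma> [j]" using s1[of i] s1[of j] by simp
    then show "i = j" using injD[OF inj, of "[i]" "[j]"] by simp
  qed
  moreover have "\<pi> ` letters \<subseteq> letters" using in_words[OF _ Nil_in_words] by auto
  ultimately have "bij_betw \<pi> letters letters"
    unfolding bij_betw_def by (simp add: endo_inj_surj)
  then show p: "\<pi> permutes letters" by (rule bij_imp_permutes) (simp add: \<pi>_def)
  show "f i \<in> tree_auts n" if i: "i \<in> letters" for i
  proof -
    have "inj_on (f i) (words n)"
    proof (rule inj_onI)
      fix w v assume "w \<in> words n" "v \<in> words n" "f i w = f i v"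
      then have "\<sigma> (i # w) = \<sigma> (i # v)" using sw[OF i, of w] sw[OF i, of v] by simp
      then show "w = v" using injD[OF inj, of "i # w" "i # v"] by simp
    qed
    moreover have "f i ` words n \<subseteq> words n" using in_words[OF i] by auto
    ultimately have "bij_betw (f i) (words n) (words n)"
      unfolding bij_betw_def using finite_words by (simp add: endo_inj_surj)
    then have "f i permutes words n" by (rule bij_imp_permutes) (simp add: f_def)
    moreover have "f i [] = []" using s1[OF i] by (simp add: f_def)
    moreover have "is_child (f i w) (f i v) \<longleftrightarrow> is_child w v"
      if "w \<in> words n" "v \<in> words n" for w v
      using sD(3)[of "i # w" "i # v"] that i sw[OF i] 
      by (auto simp: Cons_in_words_Suc is_child_def)
    ultimately show ?thesis by (simp add: tree_auts_def)
  qed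
  show "\<sigma> = branch (Suc n) f \<pi>"
  proof
    fix w show "\<sigma> w = branch (Suc n) f \<pi> w"
    proof (cases w)
      case (Cons i v)
      show ?thesis
      proof (cases "w \<in> words (Suc n)")
        case True
        then have "i \<in> letters" "v \<in> words n" using Cons by (auto simp: Cons_in_words_Suc)
        then show ?thesis unfolding Cons using sw branch_Cons by metis
      next
        case False
        then show ?thesis using permutes_not_in[OF sD(1)] by (simp add: branch_outside)
      qed
    qed (simp add: sD(2))
  qed
qed

lemma branch_eqD:
  assumes eq: "branch (Suc n) f \<pi> = branch (Suc n) g \<rho>"
    and f: "\<And>i. i \<in> letters \<Longrightarrow> f i \<in> tree_auts n" and g: "\<And>i. i \<in> letters \<Longrightarrow> g i \<in> tree_auts n"
    and i: "i \<in> letters"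
  shows "f i = g i" "\<pi> i = \<rho> i"
proof -
  have *: "\<pi> i # f i w = \<rho> i # g i w" if "w \<in> words n" for w
    using fun_cong[OF eq, of "i # w"] unfolding branch_Cons[OF i that] .
  show "\<pi> i = \<rho> i" using *[OF Nil_in_words] by simp
  show "f i = g i"
  proof
    fix w show "f i w = g i w"
      using * permutes_not_in[OF tree_autsD(1)[OF f[OF i]]]
        permutes_not_in[OF tree_autsD(1)[OF g[OF i]]] by (cases "w \<in> words n") auto
  qed
qed

text \<open>Values of \<open>f\<close> off \<open>letters\<close> do not affect
  \<open>branch\<close>. Restricting to extensional functions makes the decomposition unique, so
  that groups can be counted by pairs.\<close>

lemma inj_on_branch:
  assumes "A \<subseteq> tree_auts n"
  shows "inj_on (\<lambda>(f, \<pi>). branch (Suc n) f \<pi>) ((letters \<rightarrow>\<^sub>E A) \<times> {\<pi>. \<pi> permutes letters})"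
proof (rule inj_onI, clarsimp)
  fix f \<pi> g \<rho>
  assume f: "f \<in> letters \<rightarrow>\<^sub>E A" and g: "g \<in> letters \<rightarrow>\<^sub>E A" and p: "\<pi> permutes letters" "\<rho> permutes letters"
    and eq: "branch (Suc n) f \<pi> = branch (Suc n) g \<rho>"
  have "f i \<in> tree_auts n" "g i \<in> tree_auts n" if "i \<in> letters" for i
    using f g assms that by (meson PiE_mem subsetD)+
  note e = branch_eqD[OF eq this]
  have "f = g" using e(1) by (intro PiE_ext[OF f g]) auto
  moreover have "\<pi> i = \<rho> i" for i
    using e(2)[of i] permutes_not_in[OF p(1)] permutes_not_in[OF p(2)] by (cases "i \<in> letters") auto
  ultimately show "f = g \<and> \<pi> = \<rho>" by auto
qed

section \<open>The order of the full automorphism group\<close>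

lemma tree_auts_Suc:
  "tree_auts (Suc n) = (\<lambda>(f, \<pi>). branch (Suc n) f \<pi>) ` ((letters \<rightarrow>\<^sub>E tree_auts n) \<times> {\<pi>. \<pi> permutes letters})"
proof (intro equalityI subsetI)
  fix \<sigma> assume "\<sigma> \<in> tree_auts (Suc n)"
  then obtain f \<pi> where f: "\<And>i. i \<in> letters \<Longrightarrow> f i \<in> tree_auts n" "\<pi> permutes letters"
    and s: "\<sigma> = branch (Suc n) f \<pi>"
    by (rule tree_auts_Suc_branchE) blast
  have "\<sigma> = branch (Suc n) (restrict f letters) \<pi>"
    unfolding s by (rule branch_cong) auto
  moreover have "restrict f letters \<in> letters \<rightarrow>\<^sub>E tree_auts n" using f by auto
  ultimately show "\<sigma> \<in> (\<lambda>(f, \<pi>). branch (Suc n) f \<pi>) ` ((letters \<rightarrow>\<^sub>E tree_auts n) \<times> {\<pi>. \<pi> permutes letters})"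
    using f by force
next
  fix \<sigma> assume "\<sigma> \<in> (\<lambda>(f, \<pi>). branch (Suc n) f \<pi>) ` ((letters \<rightarrow>\<^sub>E tree_auts n) \<times> {\<pi>. \<pi> permutes letters})"
  then show "\<sigma> \<in> tree_auts (Suc n)"
    by clarify (rule branch_in_tree_auts; blast dest: PiE_mem)
qed

lemma tree_auts_0: "tree_auts 0 = {id}"
proof -
  have w: "words 0 = {[]}" by (auto simp: words_def)
  have "\<sigma> = id" if "\<sigma> \<in> tree_auts 0" for \<sigma>
    using tree_autsD(1)[OF that] unfolding w permutes_sing .
  then show ?thesis using id_in_tree_auts by blast
qed

lemma card_perms_letters: "card {\<pi>. \<pi> permutes letters} = 6"
  using card_permutations[of letters 3] by (simp add: fact_numeral)

lemma card_tree_auts_Suc: "card (tree_auts (Suc n)) = 6 * card (tree_auts n) ^ 3"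
  unfolding tree_auts_Suc card_image[OF inj_on_branch[OF subset_refl]]
    card_cartesian_product card_perms_letters
  by (simp add: card_PiE)

lemma finite_tree_auts: "finite (tree_auts n)"
  by (rule finite_subset[OF _ finite_permutations[OF finite_words[of n]]]) (auto simp: tree_auts_def)


subsection \<open>The parity group\<close>

text \<open>The root permutation is read off directly from one-letter words, so no decomposition has
  to be chosen. The identity gets sign 1 at level 0 too, where it is the only automorphism.\<close>

definition root_sign :: "(word \<Rightarrow> word) \<Rightarrow> int" where
  "root_sign \<sigma> = sign (\<lambda>i. if i \<in> letters then hd (\<sigma> [i]) else i)"

lemma permutation_letters: "\<pi> permutes letters \<Longrightarrow> permutation \<pi>"
  by (rule permutes_imp_permutation) simp_all

lemma root_sign_branch:
  assumes "\<pi> permutes letters"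
  shows "root_sign (branch (Suc n) f \<pi>) = sign \<pi>"
proof -
  have "(\<lambda>i. if i \<in> letters then hd (branch (Suc n) f \<pi> [i]) else i) = \<pi>"
    using permutes_not_in[OF assms] by (auto simp: branch_Cons)
  then show ?thesis by (simp add: root_sign_def)
qed

lemma root_sign_id [simp]: "root_sign id = 1"
proof -
  have "(\<lambda>i. if i \<in> letters then hd (id [i]) else i) = id" by auto
  then show ?thesis unfolding root_sign_def by simp
qed

lemma root_sign_comp:
  assumes "\<sigma> \<in> tree_auts n" "\<tau> \<in> tree_auts n"
  shows "root_sign (\<tau> \<circ> \<sigma>) = root_sign \<tau> * root_sign \<sigma>"
proof (cases n)
  case 0
  then show ?thesis using assms by (simp add: tree_auts_0)
next
  case (Suc m)
  obtain f \<pi> where f: "\<And>i. i \<in> letters \<Longrightarrow> f i \<in> tree_auts m" "\<pi> permutes letters"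
    and s: "\<sigma> = branch (Suc m) f \<pi>"
    using assms(1) unfolding Suc by (rule tree_auts_Suc_branchE) blast
  obtain g \<rho> where r: "\<rho> permutes letters" and t: "\<tau> = branch (Suc m) g \<rho>"
    using assms(2) unfolding Suc by (rule tree_auts_Suc_branchE) blast
  have "\<tau> \<circ> \<sigma> = branch (Suc m) (\<lambda>i. g (\<pi> i) \<circ> f i) (\<rho> \<circ> \<pi>)"
    unfolding s t using f by (rule branch_comp)
  then show ?thesis
    using root_sign_branch permutes_compose[OF f(2) r] f(2) r
    by (simp add: s t sign_compose permutation_letters)
qed

lemma root_sign_cases: "root_sign \<sigma> = 1 \<or> root_sign \<sigma> = -1"
  unfolding root_sign_def by (meson sign_cases)

text \<open>No inverses need checking, by finiteness: composing with an element of \<open>S\<close>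
  is an injective self-map of \<open>S\<close>, hence surjective, hence it hits
  \<open>id\<close>.\<close>

lemma subgroup_Aut_treeI:
  assumes S: "S \<subseteq> tree_auts n" "id \<in> S"
    and closed: "\<And>\<sigma> \<tau>. \<sigma> \<in> S \<Longrightarrow> \<tau> \<in> S \<Longrightarrow> \<tau> \<circ> \<sigma> \<in> S"
  shows "subgroup S (Aut_tree n)"
proof (unfold_locales)
  fix \<sigma> assume s: "\<sigma> \<in> S"
  have inj: "inj \<sigma>" using permutes_inj[OF tree_autsD(1)] s S(1) by blast
  have "inj_on (\<lambda>\<tau>. \<sigma> \<circ> \<tau>) S"
    using fun.inj_map[OF inj] by (rule inj_on_subset) simp
  moreover have "(\<lambda>\<tau>. \<sigma> \<circ> \<tau>) ` S \<subseteq> S" using closed s by auto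
  ultimately have "(\<lambda>\<tau>. \<sigma> \<circ> \<tau>) ` S = S"
    using finite_subset[OF S(1) finite_tree_auts] by (intro endo_inj_surj) auto
  then obtain \<tau> where t: "\<tau> \<in> S" "\<sigma> \<circ> \<tau> = id" using S(2) by (metis imageE)
  have "inv\<^bsub>Aut_tree n\<^esub> \<sigma> = \<tau>"
    using t s S by (intro group.inv_equality[OF group_Aut_tree]) auto
  then show "inv\<^bsub>Aut_tree n\<^esub> \<sigma> \<in> S" using t by simp
qed (use assms in auto)

text \<open>The escape \<open>n = 0\<close> matters: sections at level 0 are trivial, so the sign
  condition would leave only even permutations at level 1, whereas P_1 has to be all of S_3.\<close>

primrec parity_grp :: "nat \<Rightarrow> (word \<Rightarrow> word) set" where
  "parity_grp 0 = {id}"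
| "parity_grp (Suc n) = {branch (Suc n) f \<pi> | f \<pi>. \<pi> permutes letters \<and>
     (\<forall>i\<in>letters. f i \<in> parity_grp n) \<and> (n = 0 \<or> (\<Prod>i\<in>letters. root_sign (f i)) = sign \<pi>)}"

lemma parity_grp_SucE:
  assumes "\<sigma> \<in> parity_grp (Suc n)"
  obtains f \<pi> where "\<sigma> = branch (Suc n) f \<pi>" "\<pi> permutes letters"
    "\<And>i. i \<in> letters \<Longrightarrow> f i \<in> parity_grp n"
    "n = 0 \<or> (\<Prod>i\<in>letters. root_sign (f i)) = sign \<pi>"
  using assms by auto

lemma parity_grp_SucI:
  assumes "\<pi> permutes letters" "\<And>i. i \<in> letters \<Longrightarrow> f i \<in> parity_grp n"
    "n = 0 \<or> (\<Prod>i\<in>letters. root_sign (f i)) = sign \<pi>"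
  shows "branch (Suc n) f \<pi> \<in> parity_grp (Suc n)"
  using assms by auto

declare parity_grp.simps(2) [simp del]

lemma parity_grp_subset: "parity_grp n \<subseteq> tree_auts n"
proof (induction n)
  case (Suc n)
  show ?case
    by (rule subsetI, erule parity_grp_SucE) (use Suc branch_in_tree_auts in blast)
qed (simp add: tree_auts_0)

lemma id_in_parity_grp: "id \<in> parity_grp n"
proof (induction n)
  case (Suc n)
  have "branch (Suc n) (\<lambda>_. id) id \<in> parity_grp (Suc n)"
    by (rule parity_grp_SucI) (simp_all add: Suc permutes_id)
  moreover have "branch (Suc n) (\<lambda>_. id) id = id" by (rule branch_id) (rule refl)
  ultimately show ?case by (simp only:)
qed (simp flip: id_def)

lemma parity_grp_comp: "\<sigma> \<in> parity_grp n \<Longrightarrow> \<tau> \<in> parity_grp n \<Longrightarrow> \<tau> \<circ> \<sigma> \<in> parity_grp n"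
proof (induction n arbitrary: \<sigma> \<tau>)
  case (Suc n)
  obtain f \<pi> where s: "\<sigma> = branch (Suc n) f \<pi>" and p: "\<pi> permutes letters"
    and f: "\<And>i. i \<in> letters \<Longrightarrow> f i \<in> parity_grp n"
    and fs: "n = 0 \<or> (\<Prod>i\<in>letters. root_sign (f i)) = sign \<pi>"
    using Suc.prems(1) by (rule parity_grp_SucE) blast
  obtain g \<rho> where t: "\<tau> = branch (Suc n) g \<rho>" and r: "\<rho> permutes letters"
    and g: "\<And>i. i \<in> letters \<Longrightarrow> g i \<in> parity_grp n"
    and gs: "n = 0 \<or> (\<Prod>i\<in>letters. root_sign (g i)) = sign \<rho>"
    using Suc.prems(2) by (rule parity_grp_SucE) blast
  have gp: "g (\<pi> i) \<in> parity_grp n" if "i \<in> letters" for i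
    using g permutes_in_image[OF p] that by simp
  have "(\<Prod>i\<in>letters. root_sign (g (\<pi> i) \<circ> f i))
      = (\<Prod>i\<in>letters. root_sign (g (\<pi> i)) * root_sign (f i))"
    by (intro prod.cong refl root_sign_comp[of _ n]) (use f gp parity_grp_subset in blast)+
  \<comment> \<open>The inner permutation only reorders the factors belonging to
    \<open>g\<close>.\<close>
  also have "\<dots> = (\<Prod>i\<in>letters. root_sign (g i)) * (\<Prod>i\<in>letters. root_sign (f i))"
    using prod.permute[OF p, of "\<lambda>i. root_sign (g i)"] by (simp add: prod.distrib o_def)
  finally have "n = 0 \<or> (\<Prod>i\<in>letters. root_sign (g (\<pi> i) \<circ> f i)) = sign (\<rho> \<circ> \<pi>)"
    using fs gs p r by (auto simp: sign_compose permutation_letters)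
  then have "branch (Suc n) (\<lambda>i. g (\<pi> i) \<circ> f i) (\<rho> \<circ> \<pi>) \<in> parity_grp (Suc n)"
    using Suc.IH f gp by (intro parity_grp_SucI permutes_compose[OF p r]) blast+
  moreover have "\<tau> \<circ> \<sigma> = branch (Suc n) (\<lambda>i. g (\<pi> i) \<circ> f i) (\<rho> \<circ> \<pi>)"
    unfolding s t using f parity_grp_subset by (intro branch_comp[OF _ p]) blast
  ultimately show ?case by simp
qed simp

lemma subgroup_parity_grp: "subgroup (parity_grp n) (Aut_tree n)"
  by (intro subgroup_Aut_treeI parity_grp_subset id_in_parity_grp parity_grp_comp)

text \<open>This is an explicit description of L_n; the two inclusions are
  \<open>L_grp_subset_even_grp\<close> and \<open>even_grp_subset_L_grp\<close>.\<close>

definition even_grp :: "nat \<Rightarrow> (word \<Rightarrow> word) set" where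
  "even_grp n = {\<sigma> \<in> parity_grp n. root_sign \<sigma> = 1}"

lemma subgroup_even_grp: "subgroup (even_grp n) (Aut_tree n)"
proof (rule subgroup_Aut_treeI)
  fix \<sigma> \<tau> assume "\<sigma> \<in> even_grp n" "\<tau> \<in> even_grp n"
  then show "\<tau> \<circ> \<sigma> \<in> even_grp n"
    using parity_grp_comp root_sign_comp[of \<sigma> n \<tau>] parity_grp_subset
    by (auto simp: even_grp_def subset_iff)
qed (use parity_grp_subset id_in_parity_grp in \<open>auto simp: even_grp_def\<close>)

subsection \<open>The generators and the groups \<open>L\<^sub>n\<close>\<close>

definition rot :: "nat \<Rightarrow> nat" where "rot = cycle_of_list [0, 1, 2]"

definition swap01 :: "nat \<Rightarrow> nat" where "swap01 = cycle_of_list [0, 1]"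

lemma rot_permutes: "rot permutes letters"
  using cycle_permutes[of "[0, 1, 2::nat]"] by (simp add: rot_def letters_def)

lemma swap01_permutes: "swap01 permutes letters"
  unfolding swap01_def by (rule permutes_subset[OF cycle_permutes]) (auto simp: letters_def)

lemma rot_apply: "rot 0 = 1" "rot 1 = 2" "rot 2 = 0"
  by (simp_all add: rot_def transpose_def)

lemma sign_rot: "sign rot = 1"
  by (simp add: rot_def sign_compose sign_swap_id permutation_swap_id)

lemma sign_swap01: "sign swap01 = -1"
  by (simp add: swap01_def sign_swap_id)

text \<open>Since the fillers at index 0 are \<open>id\<close>, one recursion covers level 1 as
  well; the same holds for \<open>y_gen\<close> and \<open>z_gen\<close>. Inductions can thus start
  at 0.\<close>

lemma x_gen_Suc: "x_gen (Suc n) = branch (Suc n) ((!) [id, id, x_gen n]) rot"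
  by (cases n) (simp_all add: wreath_eq_branch rot_def swap01_def)

lemma y_gen_Suc: "y_gen (Suc n) = branch (Suc n) ((!) [id, y_gen n, x_gen n]) swap01"
  by (cases n) (simp_all add: wreath_eq_branch rot_def swap01_def)

lemma z_gen_Suc: "z_gen (Suc n) = branch (Suc n) ((!) [y_gen n, y_gen n, x_gen n]) id"
proof (cases n)
  case 0
  have "branch 1 ((!) [id, id, id]) id = id" by (rule branch_id) (auto simp: letters_def)
  then show ?thesis using 0 by simp
qed (simp add: wreath_eq_branch)

lemma embed_eq_branch: "embed n \<sigma> = branch n ((!) [\<sigma>, id, id]) id"
  by (simp add: embed_def wreath_eq_branch)

lemma x_gen_in_even_grp: "x_gen n \<in> even_grp n"
proof (induction n)
  case (Suc n)
  then have "x_gen (Suc n) \<in> parity_grp (Suc n)"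
    unfolding x_gen_Suc using id_in_parity_grp sign_rot
    by (intro parity_grp_SucI[OF rot_permutes])
      (auto simp: letters_def even_grp_def)
  then show ?case
    by (simp add: even_grp_def x_gen_Suc root_sign_branch rot_permutes sign_rot)
qed (simp add: even_grp_def flip: id_def)

text \<open>From level 2 on exactly one section, the smaller \<open>y_gen\<close>, is odd, which
  matches the odd transposition at the root. At index 0 the filler \<open>id\<close> is even, hence
  the restriction on the sign.\<close>

lemma y_gen_in_parity_grp: "y_gen n \<in> parity_grp n \<and> (n > 0 \<longrightarrow> root_sign (y_gen n) = -1)"
proof (induction n)
  case (Suc n)
  then have "y_gen (Suc n) \<in> parity_grp (Suc n)"
    unfolding y_gen_Suc using id_in_parity_grp sign_swap01 x_gen_in_even_grp[of n]
    by (intro parity_grp_SucI[OF swap01_permutes])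
      (auto simp: letters_def even_grp_def)
  then show ?case
    by (simp add: y_gen_Suc root_sign_branch swap01_permutes sign_swap01)
qed (simp flip: id_def)

lemma root_sign_sq [simp]: "root_sign \<sigma> * root_sign \<sigma> = 1"
  using root_sign_cases[of \<sigma>] by auto

lemma z_gen_in_even_grp: "z_gen (Suc n) \<in> even_grp (Suc n)"
proof -
  have "z_gen (Suc n) \<in> parity_grp (Suc n)"
    \<comment> \<open>The odd section \<open>y_gen n\<close> occurs twice, so its signs
      cancel.\<close>
    unfolding z_gen_Suc using x_gen_in_even_grp[of n] y_gen_in_parity_grp[of n]
    by (intro parity_grp_SucI) (auto simp: letters_def even_grp_def permutes_id)
  then show ?thesis by (simp add: even_grp_def z_gen_Suc root_sign_branch permutes_id)
qed

lemma embed_in_even_grp: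
  assumes "\<sigma> \<in> even_grp n"
  shows "embed (Suc n) \<sigma> \<in> even_grp (Suc n)"
proof -
  have "embed (Suc n) \<sigma> \<in> parity_grp (Suc n)"
    unfolding embed_eq_branch using assms id_in_parity_grp
    by (intro parity_grp_SucI) (auto simp: letters_def even_grp_def permutes_id)
  then show ?thesis by (simp add: even_grp_def embed_eq_branch root_sign_branch permutes_id)
qed

lemma even_grp_subset: "even_grp n \<subseteq> tree_auts n"
  using parity_grp_subset by (auto simp: even_grp_def)

text \<open>At level 1 the extra generators \<open>z_gen 1\<close> and the embedded identity are
  both \<open>id\<close>, so the general recursion also yields the separately defined L_1.\<close>

lemma L_grp_Suc: "L_grp (Suc n) =
  generate (Aut_tree (Suc n)) ({x_gen (Suc n), z_gen (Suc n)} \<union> embed (Suc n) ` L_grp n)"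
proof (cases n)
  case 0
  interpret group "Aut_tree (Suc 0)" by (rule group_Aut_tree)
  have x: "{x_gen (Suc 0)} \<subseteq> carrier (Aut_tree (Suc 0))"
    using x_gen_in_even_grp even_grp_subset unfolding carrier_Aut_tree by blast
  have "embed (Suc 0) id = id"
    unfolding embed_eq_branch by (rule branch_id) (auto simp: letters_def)
  then have gens: "{x_gen (Suc 0), z_gen (Suc 0)} \<union> embed (Suc 0) ` L_grp 0 = {x_gen (Suc 0), id}"
    by (auto simp del: x_gen.simps)
  have "generate (Aut_tree (Suc 0)) {x_gen (Suc 0), id} \<subseteq> generate (Aut_tree (Suc 0)) {x_gen (Suc 0)}"
    using generate.one[of "Aut_tree (Suc 0)"]
    by (intro generate_subgroup_incl generate_is_subgroup[OF x]) (auto intro: generate.incl)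
  moreover have "generate (Aut_tree (Suc 0)) {x_gen (Suc 0)} \<subseteq> generate (Aut_tree (Suc 0)) {x_gen (Suc 0), id}"
    by (rule mono_generate) blast
  ultimately show ?thesis unfolding 0 gens L_grp.simps(2) One_nat_def by (rule equalityI[rotated])
qed (simp only: L_grp.simps)

lemma L_gens_subset:
  assumes "L_grp n \<subseteq> even_grp n"
  shows "{x_gen (Suc n), z_gen (Suc n)} \<union> embed (Suc n) ` L_grp n \<subseteq> even_grp (Suc n)"
  using assms embed_in_even_grp x_gen_in_even_grp z_gen_in_even_grp by blast

lemma L_grp_subset_even_grp: "L_grp n \<subseteq> even_grp n"
proof (induction n)
  case 0
  show ?case by (simp add: even_grp_def)
next
  case (Suc n)
  show ?case
    unfolding L_grp_Suc
    by (rule group.generate_subgroup_incl[OF group_Aut_tree L_gens_subset[OF Suc] subgroup_even_grp])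
qed

lemma L_grp_subset: "L_grp n \<subseteq> tree_auts n"
  using L_grp_subset_even_grp even_grp_subset by blast

lemma subgroup_L_grp: "subgroup (L_grp n) (Aut_tree n)"
proof (cases n)
  case 0
  then show ?thesis by (auto intro: subgroup_Aut_treeI simp: id_in_tree_auts)
next
  case (Suc m)
  have "{x_gen (Suc m), z_gen (Suc m)} \<union> embed (Suc m) ` L_grp m \<subseteq> carrier (Aut_tree (Suc m))"
    unfolding carrier_Aut_tree
    using L_gens_subset[OF L_grp_subset_even_grp] even_grp_subset by blast
  then show ?thesis
    unfolding Suc L_grp_Suc by (rule group.generate_is_subgroup[OF group_Aut_tree])
qed

lemma x_gen_in_L_grp: "x_gen n \<in> L_grp n"
  by (cases n) (auto simp only: L_grp_Suc x_gen.simps L_grp.simps intro: generate.incl)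

lemma z_gen_in_L_grp: "z_gen (Suc n) \<in> L_grp (Suc n)"
  unfolding L_grp_Suc by (rule generate.incl) blast

lemma embed_in_L_grp: "embed (Suc n) ` L_grp n \<subseteq> L_grp (Suc n)"
  unfolding L_grp_Suc by (blast intro: generate.incl)

section \<open>From the embedded copy of L_(n-1) to its cube\<close>

lemma subgroup_comp:
  assumes "subgroup S (Aut_tree n)" "\<sigma> \<in> S" "\<tau> \<in> S"
  shows "\<tau> \<circ> \<sigma> \<in> S"
  using subgroup.m_closed[OF assms] by simp

lemma group_L_group: "group (L_group n)"
  by (rule group.subgroup_imp_group[OF group_Aut_tree subgroup_L_grp])


text \<open>Conjugation by \<open>x_gen (Suc n)\<close> turns (a, b, id) into (id, a, b), so the
  copy of L_n in the first coordinate spreads to the other two. It is applied to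
  \<open>H_grp\<close> and, with \<open>N\<close> the whole group, to \<open>L_grp\<close>
  itself.\<close>

lemma cube_subset_normal:
  assumes N: "N \<lhd> L_group (Suc n)" and emb: "embed (Suc n) ` L_grp n \<subseteq> N"
    and f: "\<And>i. i \<in> letters \<Longrightarrow> f i \<in> L_grp n"
  shows "branch (Suc n) f id \<in> N"
proof -
  let ?D = "\<lambda>a b c. branch (Suc n) ((!) [a, b, c]) id" and ?x = "x_gen (Suc n)"
  have x: "?x \<in> tree_auts (Suc n)" "x_gen n \<in> tree_auts n"
    using x_gen_in_L_grp L_grp_subset by blast+
  \<comment> \<open>The only nontrivial section of \<open>?x\<close> is at letter 2, where on both
    sides it meets an identity section; so nothing is conjugated inside the coordinates.\<close>
  have shift: "?D id a b \<circ> ?x = ?x \<circ> ?D a b id" if "a \<in> tree_auts n" "b \<in> tree_auts n" for a b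
  proof -
    have "?D id a b \<circ> ?x
        = branch (Suc n) (\<lambda>i. [id, a, b] ! rot i \<circ> [id, id, x_gen n] ! i) (id \<circ> rot)"
      unfolding x_gen_Suc using x(2)
      by (intro branch_comp rot_permutes) (auto simp: letters_def id_in_tree_auts)
    also have "\<dots> = branch (Suc n) (\<lambda>i. [id, id, x_gen n] ! id i \<circ> [a, b, id] ! i) (rot \<circ> id)"
      by (rule branch_cong) (auto simp: letters_def rot_apply rot_apply(2)[simplified])
    also have "\<dots> = ?x \<circ> ?D a b id"
      unfolding x_gen_Suc using that
      by (intro branch_comp[symmetric] permutes_id)
        (auto simp: letters_def id_in_tree_auts simp flip: id_def)
    finally show ?thesis .
  qed
  \<comment> \<open>Normality in the form Nx = xN, which avoids inverses; \<open>?x\<close> is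
    cancelled afterwards by surjectivity.\<close>
  have conj: "\<exists>h'\<in>N. h' \<circ> ?x = ?x \<circ> h" if "h \<in> N" for h
  proof -
    have "N #>\<^bsub>L_group (Suc n)\<^esub> ?x = ?x <#\<^bsub>L_group (Suc n)\<^esub> N"
      using normal.coset_eq[OF N] x_gen_in_L_grp[of "Suc n"] by simp
    moreover have "h \<otimes>\<^bsub>L_group (Suc n)\<^esub> ?x \<in> N #>\<^bsub>L_group (Suc n)\<^esub> ?x"
      using that by (auto simp: r_coset_def)
    ultimately show ?thesis by (auto simp: l_coset_def)
  qed
  have surj: "surj ?x" using x(1) tree_autsD(1) permutes_surj by blast
  have shift_in: "?D id a b \<in> N" if h: "?D a b id \<in> N" "a \<in> tree_auts n" "b \<in> tree_auts n" for a b
  proof -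
    obtain h' where h': "h' \<in> N" "h' \<circ> ?x = ?x \<circ> ?D a b id" using conj[OF h(1)] by blast
    have "h' \<circ> ?x = ?D id a b \<circ> ?x" using shift[OF h(2,3)] h'(2) by simp
    then have "h' (?x v) = ?D id a b (?x v)" for v by (metis comp_apply)
    then have "h' = ?D id a b" using surj by (metis ext surjD)
    then show ?thesis using h'(1) by simp
  qed
  have comp: "\<tau> \<circ> \<sigma> \<in> N" if "\<sigma> \<in> N" "\<tau> \<in> N" for \<sigma> \<tau>
    using subgroup.m_closed[OF normal_imp_subgroup[OF N] that] by simp
  have D0: "?D a id id \<in> N" if "a \<in> L_grp n" for a
    using emb that by (auto simp: embed_eq_branch)
  have D1: "?D id a id \<in> N" if "a \<in> L_grp n" for a
    using shift_in[OF D0[OF that]] that L_grp_subset id_in_tree_auts by blast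
  have D2: "?D id id a \<in> N" if "a \<in> L_grp n" for a
    using shift_in[OF D1[OF that]] that L_grp_subset id_in_tree_auts by blast
  have fL: "f 0 \<in> L_grp n" "f 1 \<in> L_grp n" "f 2 \<in> L_grp n"
    using f by (auto simp: letters_def)
  then have fa: "f 0 \<in> tree_auts n" "f 1 \<in> tree_auts n" "f 2 \<in> tree_auts n"
    using L_grp_subset by blast+
  have "branch (Suc n) f id = ?D (f 0) (f 1) (f 2)"
    by (rule branch_cong) (auto simp: letters_def)
  also have "\<dots> = ?D id id (f 2) \<circ> (?D id (f 1) id \<circ> ?D (f 0) id id)"
    using fa by (simp add: branch_triple_comp id_in_tree_auts)
  also have "\<dots> \<in> N" by (intro comp D0 D1 D2 fL)
  finally show ?thesis .
qed

lemma L_grp_normal_self: "L_grp n \<lhd> L_group n"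
  using group.normal_self[OF group_L_group] by simp


subsection \<open>\<open>L\<^sub>n\<close> is the even part of the parity group\<close>

text \<open>Composing with a transposition injects each sign class into the other, so the six
  permutations split evenly.\<close>

lemma card_sign_perms:
  assumes "s = 1 \<or> s = -1"
  shows "card {\<pi>. \<pi> permutes letters \<and> sign \<pi> = s} = 3"
proof -
  let ?P = "\<lambda>s. {\<pi>. \<pi> permutes letters \<and> sign \<pi> = s}"
  have fin: "finite (?P s)" for s
    by (rule finite_subset[OF _ finite_permutations[OF finite_letters]]) auto
  have le: "card (?P s) \<le> card (?P (- s))" for s
  proof (rule card_inj_on_le[OF _ _ fin])
    have "inj swap01" using swap01_permutes by (rule permutes_inj)
    from fun.inj_map[OF this] show "inj_on ((\<circ>) swap01) (?P s)"
      by (rule inj_on_subset) simp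
    show "(\<circ>) swap01 ` ?P s \<subseteq> ?P (- s)"
      using permutes_compose[OF _ swap01_permutes] swap01_permutes
      by (auto simp: sign_compose permutation_letters sign_swap01)
  qed
  have eq: "card (?P 1) = card (?P (- 1))" using le[of 1] le[of "-1"] by simp
  have "card {\<pi>. \<pi> permutes letters} = card (?P 1 \<union> ?P (- 1))"
    by (rule arg_cong[of _ _ card]) (auto intro: sign_cases)
  also have "\<dots> = card (?P 1) + card (?P (- 1))" by (rule card_Un_disjoint[OF fin fin]) auto
  finally have "card (?P 1) + card (?P (- 1)) = 6" by (simp add: card_perms_letters)
  then show ?thesis using assms eq by auto
qed

lemma even_perms: "{\<pi>. \<pi> permutes letters \<and> sign \<pi> = 1} = {id, rot, rot \<circ> rot}"
proof (rule sym, rule card_subset_eq)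
  show "finite {\<pi>. \<pi> permutes letters \<and> sign \<pi> = 1}"
    by (rule finite_subset[OF _ finite_permutations[OF finite_letters]]) auto
  show "{id, rot, rot \<circ> rot} \<subseteq> {\<pi>. \<pi> permutes letters \<and> sign \<pi> = 1}"
    using permutes_compose[OF rot_permutes rot_permutes] rot_permutes
    by (auto simp: permutes_id sign_compose permutation_letters sign_rot)
  have "id \<noteq> rot" "id \<noteq> rot \<circ> rot" "rot \<noteq> rot \<circ> rot"
    by (auto simp: rot_apply dest!: fun_cong[of _ _ 0] simp del: One_nat_def)
  then show "card {id, rot, rot \<circ> rot} = card {\<pi>. \<pi> permutes letters \<and> sign \<pi> = 1}"
    by (simp add: card_sign_perms)
qed

text \<open>The cube of L_n lies in L_(n+1). Modulo this cube, \<open>x_gen (Suc n)\<close> becomes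
  a pure rotation and \<open>z_gen (Suc n)\<close> becomes (y, y, id), whose rotations put y in any
  two coordinates. An even element has zero or two odd sections, and each odd section is an element
  of L_n times y.\<close>

lemma even_grp_subset_L_grp: "even_grp n \<subseteq> L_grp n"
proof (induction n)
  case (Suc n)
  interpret A: group "Aut_tree n" by (rule group_Aut_tree)
  let ?D = "\<lambda>a b c. branch (Suc n) ((!) [a, b, c]) id" and ?x = "x_gen n" and ?y = "y_gen n"
  let ?R = "branch (Suc n) (\<lambda>_. id)"
  note cube = cube_subset_normal[OF L_grp_normal_self embed_in_L_grp]
  note comp = subgroup_comp[OF subgroup_L_grp[of "Suc n"]]
  have idL: "id \<in> L_grp n" using subgroup.one_closed[OF subgroup_L_grp[of n]] by simp
  have x: "?x \<in> tree_auts n" and y: "?y \<in> tree_auts n" "?y \<in> parity_grp n"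
    using x_gen_in_L_grp L_grp_subset y_gen_in_parity_grp parity_grp_subset by blast+
  define x' where "x' = inv\<^bsub>Aut_tree n\<^esub> ?x"
  define y' where "y' = inv\<^bsub>Aut_tree n\<^esub> ?y"
  have x': "x' \<in> L_grp n" "?x \<circ> x' = id"
    using subgroup.m_inv_closed[OF subgroup_L_grp x_gen_in_L_grp] A.l_inv[of ?x] x
    by (simp_all add: x'_def)
  have y': "y' \<in> parity_grp n" "y' \<circ> ?y = id"
    using subgroup.m_inv_closed[OF subgroup_parity_grp y(2)] A.r_inv[of ?y] y
    by (simp_all add: y'_def)
  have x'a: "x' \<in> tree_auts n" and y'a: "y' \<in> tree_auts n"
    using x' y' L_grp_subset parity_grp_subset by blast+
  have D_L: "?D a b c \<in> L_grp (Suc n)" if "a \<in> L_grp n" "b \<in> L_grp n" "c \<in> L_grp n" for a b c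
    using that by (intro cube) (auto simp: letters_def)
  \<comment> \<open>The cube element (id, id, x') cancels the section at letter 2 of
    \<open>x_gen (Suc n)\<close>.\<close>
  have R: "?R rot \<in> L_grp (Suc n)"
  proof -
    have "x_gen (Suc n) \<circ> ?D id id x'
        = branch (Suc n) (\<lambda>i. [id, id, ?x] ! id i \<circ> [id, id, x'] ! i) (rot \<circ> id)"
      unfolding x_gen_Suc using x'a
      by (intro branch_comp permutes_id) (auto simp: letters_def id_in_tree_auts simp flip: id_def)
    also have "\<dots> = ?R rot"
      by (rule branch_cong) (auto simp: letters_def x'(2))
    finally show ?thesis using comp[OF D_L[OF idL idL x'(1)] x_gen_in_L_grp] by simp
  qed
  have R_comp: "?R \<rho> \<circ> branch (Suc n) f \<pi> = branch (Suc n) f (\<rho> \<circ> \<pi>)"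
    if "\<And>i. i \<in> letters \<Longrightarrow> f i \<in> tree_auts n" "\<pi> permutes letters" for \<rho> \<pi> f
    by (subst branch_comp[OF that]) (simp_all add: id_comp)
  have comp_R: "branch (Suc n) f \<rho> \<circ> ?R \<pi> = branch (Suc n) (\<lambda>i. f (\<pi> i)) (\<rho> \<circ> \<pi>)"
    if "\<pi> permutes letters" for \<rho> \<pi> f
    by (subst branch_comp[OF _ that]) (simp_all add: id_in_tree_auts flip: id_def)
  have rot3: "rot \<circ> rot \<circ> rot = id"
  proof
    fix i show "(rot \<circ> rot \<circ> rot) i = id i"
      using permutes_not_in[OF rot_permutes, of i] rot_apply
      by (cases "i \<in> letters") (auto simp: letters_def)
  qed
  have RR: "?R (rot \<circ> rot) \<in> L_grp (Suc n)"
    using comp[OF R R] comp_R[OF rot_permutes, of "\<lambda>_. id" rot] by simp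
  have rotate: "?D b c a \<in> L_grp (Suc n)"
    if "?D a b c \<in> L_grp (Suc n)" "a \<in> tree_auts n" "b \<in> tree_auts n" "c \<in> tree_auts n" for a b c
  proof -
    \<comment> \<open>\<open>rot \<circ> rot\<close> is the inverse of \<open>rot\<close>, so this
      is a conjugation by the pure rotation.\<close>
    have "?R (rot \<circ> rot) \<circ> (?D a b c \<circ> ?R rot)
        = ?R (rot \<circ> rot) \<circ> branch (Suc n) (\<lambda>i. [a, b, c] ! rot i) rot"
      using comp_R[OF rot_permutes] by simp
    also have "\<dots> = branch (Suc n) (\<lambda>i. [a, b, c] ! rot i) (rot \<circ> rot \<circ> rot)"
      using that by (intro R_comp rot_permutes) (auto simp: letters_def rot_apply rot_apply(2)[simplified])
    also have "\<dots> = ?D b c a"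
      unfolding rot3 by (rule branch_cong) (auto simp: letters_def rot_apply rot_apply(2)[simplified])
    finally show ?thesis using comp[OF comp[OF R that(1)] RR] by simp
  qed
  have "?D id id x' \<circ> z_gen (Suc n) = ?D ?y ?y (x' \<circ> ?x)"
    unfolding z_gen_Suc using branch_triple_comp[OF y(1) y(1) x] by simp
  moreover have "x' \<circ> ?x = id" using A.r_inv[of ?x] x by (simp add: x'_def)
  ultimately have yy1: "?D ?y ?y id \<in> L_grp (Suc n)"
    using comp[OF z_gen_in_L_grp D_L[OF idL idL x'(1)]] by simp
  have y1y: "?D ?y id ?y \<in> L_grp (Suc n)"
    by (rule rotate[OF yy1]) (use y id_in_tree_auts in auto)
  have "?D id ?y ?y \<in> L_grp (Suc n)"
    by (rule rotate[OF y1y]) (use y id_in_tree_auts in auto)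
  note yy = yy1 y1y this
  have odd: "a \<circ> y' \<in> L_grp n" "(a \<circ> y') \<circ> ?y = a" if "a \<in> parity_grp n" "root_sign a = -1" for a
  proof -
    have aa: "a \<in> tree_auts n" using that parity_grp_subset by blast
    \<comment> \<open>Level 0 has no odd element; for positive \<open>n\<close> the generator
      \<open>?y\<close> is odd, hence so is its inverse \<open>y'\<close>.\<close>
    have "n > 0" using that by (cases n) auto
    then have "root_sign y' * -1 = 1"
      using root_sign_comp[OF y(1) y'a] y'(2) y_gen_in_parity_grp[of n] by simp
    then have "root_sign (a \<circ> y') = 1"
      using root_sign_comp[OF y'a aa] that by simp
    then show "a \<circ> y' \<in> L_grp n"
      using parity_grp_comp[OF y'(1) that(1)] Suc by (auto simp: even_grp_def)
    show "(a \<circ> y') \<circ> ?y = a" using y'(2) by (simp add: comp_assoc)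
  qed
  have even: "a \<in> L_grp n" if "a \<in> parity_grp n" "root_sign a = 1" for a
    using that Suc by (auto simp: even_grp_def)
  show ?case
  proof
    fix \<sigma> assume s: "\<sigma> \<in> even_grp (Suc n)"
    then obtain f \<pi> where sf: "\<sigma> = branch (Suc n) f \<pi>" and p: "\<pi> permutes letters"
      and f: "\<And>i. i \<in> letters \<Longrightarrow> f i \<in> parity_grp n"
      and fs: "n = 0 \<or> (\<Prod>i\<in>letters. root_sign (f i)) = sign \<pi>"
      unfolding even_grp_def by (auto elim: parity_grp_SucE)
    have sp: "sign \<pi> = 1" using s root_sign_branch[OF p] by (simp add: even_grp_def sf)
    define a b c where "a = f 0" and "b = f 1" and "c = f 2"
    have abc: "a \<in> parity_grp n" "b \<in> parity_grp n" "c \<in> parity_grp n"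
      using f by (auto simp: a_def b_def c_def letters_def)
    have abcs: "root_sign a * root_sign b * root_sign c = 1"
    \<comment> \<open>For \<open>n = 0\<close> the parity condition says nothing, but the sections
      are then all \<open>id\<close>.\<close>
    proof (cases "n = 0")
      case True
      then show ?thesis using abc by simp
    next
      case False
      then show ?thesis using fs sp by (simp add: letters_def a_def b_def c_def mult.assoc)
    qed
    have abca: "a \<in> tree_auts n" "b \<in> tree_auts n" "c \<in> tree_auts n"
      using abc parity_grp_subset by blast+
    have D: "?D a b c \<in> L_grp (Suc n)"
    proof -
      note dc = branch_triple_comp[OF y(1) y(1) id_in_tree_auts] branch_triple_comp[OF y(1) id_in_tree_auts y(1)]
        branch_triple_comp[OF id_in_tree_auts y(1) y(1)]
      consider "root_sign a = 1" "root_sign b = 1" "root_sign c = 1"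
        | "root_sign a = -1" "root_sign b = -1" "root_sign c = 1"
        | "root_sign a = -1" "root_sign b = 1" "root_sign c = -1"
        | "root_sign a = 1" "root_sign b = -1" "root_sign c = -1"
        using root_sign_cases[of a] root_sign_cases[of b] root_sign_cases[of c] abcs
        by (elim disjE) simp_all
      then show ?thesis
      proof cases
        case 1
        then show ?thesis using abc even by (intro D_L) auto
      next
        case 2
        then have "?D (a \<circ> y') (b \<circ> y') c \<in> L_grp (Suc n)"
          using abc even odd(1) by (intro D_L) auto
        from comp[OF yy(1) this] show ?thesis
          unfolding dc using odd(2) 2 abc by simp
      next
        case 3
        then have "?D (a \<circ> y') b (c \<circ> y') \<in> L_grp (Suc n)"
          using abc even odd(1) by (intro D_L) auto
        from comp[OF yy(2) this] show ?thesis
          unfolding dc using odd(2) 3 abc by simp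
      next
        case 4
        then have "?D a (b \<circ> y') (c \<circ> y') \<in> L_grp (Suc n)"
          using abc even odd(1) by (intro D_L) auto
        from comp[OF yy(3) this] show ?thesis
          unfolding dc using odd(2) 4 abc by simp
      qed
    qed
    have "?R \<pi> \<in> L_grp (Suc n)"
    proof -
      have "\<pi> \<in> {id, rot, rot \<circ> rot}" using p sp even_perms by blast
      moreover have "?R id = id" by (rule branch_id) (rule refl)
      ultimately show ?thesis
        using R RR subgroup.one_closed[OF subgroup_L_grp[of "Suc n"]] by auto
    qed
    moreover have "\<sigma> = ?R \<pi> \<circ> ?D a b c"
    proof -
      have "?R \<pi> \<circ> ?D a b c = branch (Suc n) ((!) [a, b, c]) (\<pi> \<circ> id)"
        using abca by (intro R_comp permutes_id) (auto simp: letters_def)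
      also have "\<dots> = \<sigma>"
        unfolding sf by (rule branch_cong) (auto simp: letters_def a_def b_def c_def)
      finally show ?thesis ..
    qed
    ultimately show "\<sigma> \<in> L_grp (Suc n)" using comp[OF D] by simp
  qed
qed (auto simp: even_grp_def)

subsection \<open>Cardinalities\<close>

lemma card_branch_image:
  assumes "A \<subseteq> tree_auts n" "B \<subseteq> (letters \<rightarrow>\<^sub>E A) \<times> {\<pi>. \<pi> permutes letters}"
  shows "card ((\<lambda>(f, \<pi>). branch (Suc n) f \<pi>) ` B) = card B"
  by (rule card_image[OF inj_on_subset[OF inj_on_branch[OF assms(1)] assms(2)]])

lemma parity_grp_1: "parity_grp (Suc 0) = tree_auts (Suc 0)"
proof (rule equalityI[OF parity_grp_subset], rule subsetI)
  fix \<sigma> assume "\<sigma> \<in> tree_auts (Suc 0)"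
  then show "\<sigma> \<in> parity_grp (Suc 0)"
    by (rule tree_auts_Suc_branchE) (auto intro!: parity_grp_SucI simp: tree_auts_0)
qed

lemma card_parity_grp_1: "card (parity_grp (Suc 0)) = 6"
  by (simp add: parity_grp_1 card_tree_auts_Suc tree_auts_0)

lemma finite_parity_grp: "finite (parity_grp n)"
  using parity_grp_subset finite_tree_auts by (rule finite_subset)

text \<open>The three sections are free, and their signs select one of the two sign classes, each of
  size 3, for the root permutation. Positivity excludes level 1, where all 6 permutations
  occur.\<close>

lemma card_parity_grp_Suc:
  assumes "n > 0"
  shows "card (parity_grp (Suc n)) = 3 * card (parity_grp n) ^ 3"
proof -
  let ?F = "letters \<rightarrow>\<^sub>E parity_grp n"
  let ?S = "\<lambda>f. {\<pi>. \<pi> permutes letters \<and> sign \<pi> = (\<Prod>i\<in>letters. root_sign (f i))}"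
  have eq: "parity_grp (Suc n) = (\<lambda>(f, \<pi>). branch (Suc n) f \<pi>) ` (SIGMA f:?F. ?S f)"
  proof (intro equalityI subsetI)
    fix \<sigma> assume "\<sigma> \<in> parity_grp (Suc n)"
    then obtain f \<pi> where s: "\<sigma> = branch (Suc n) f \<pi>" and p: "\<pi> permutes letters"
      and f: "\<And>i. i \<in> letters \<Longrightarrow> f i \<in> parity_grp n"
      and fs: "n = 0 \<or> (\<Prod>i\<in>letters. root_sign (f i)) = sign \<pi>"
      by (rule parity_grp_SucE) blast
    have "\<sigma> = branch (Suc n) (restrict f letters) \<pi>"
      unfolding s by (rule branch_cong) auto
    moreover have "restrict f letters \<in> ?F" using f by auto
    moreover have "\<pi> \<in> ?S (restrict f letters)" using p fs assms by simp
    ultimately show "\<sigma> \<in> (\<lambda>(f, \<pi>). branch (Suc n) f \<pi>) ` (SIGMA f:?F. ?S f)" by blast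
  next
    fix \<sigma> assume "\<sigma> \<in> (\<lambda>(f, \<pi>). branch (Suc n) f \<pi>) ` (SIGMA f:?F. ?S f)"
    then obtain f \<pi> where s: "\<sigma> = branch (Suc n) f \<pi>" and f: "f \<in> ?F" and p: "\<pi> \<in> ?S f"
      by auto
    show "\<sigma> \<in> parity_grp (Suc n)"
      unfolding s using p PiE_mem[OF f] by (intro parity_grp_SucI) auto
  qed
  have "card (parity_grp (Suc n)) = card (SIGMA f:?F. ?S f)"
    unfolding eq by (rule card_branch_image[OF parity_grp_subset]) auto
  also have "\<dots> = (\<Sum>f\<in>?F. card (?S f))"
  proof (rule card_SigmaI)
    show "finite ?F" by (simp add: finite_PiE finite_parity_grp)
    show "\<forall>f\<in>?F. finite (?S f)"
      by (auto intro: finite_subset[OF _ finite_permutations[OF finite_letters]])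
  qed
  also have "\<dots> = (\<Sum>f\<in>?F. 3)"
  proof (intro sum.cong refl card_sign_perms)
    fix f
    have "\<bar>\<Prod>i\<in>letters. root_sign (f i)\<bar> = 1"
      unfolding abs_prod using root_sign_cases by (intro prod.neutral ballI) (metis abs_1 abs_minus_cancel)
    then show "(\<Prod>i\<in>letters. root_sign (f i)) = 1 \<or> (\<Prod>i\<in>letters. root_sign (f i)) = - 1"
      by linarith
  qed
  also have "\<dots> = 3 * card (parity_grp n) ^ 3" by (simp add: card_PiE)
  finally show ?thesis .
qed

text \<open>Composing with the odd element \<open>y_gen n\<close> injects the odd part into the even
  part.\<close>

lemma card_parity_grp_le_even_grp:
  assumes "n > 0"
  shows "card (parity_grp n) \<le> 2 * card (even_grp n)"
proof -
  let ?O = "{\<sigma> \<in> parity_grp n. root_sign \<sigma> = -1}"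
  have y: "y_gen n \<in> parity_grp n" "root_sign (y_gen n) = -1"
    using y_gen_in_parity_grp[of n] assms by auto
  have fin: "finite (even_grp n)" using finite_parity_grp by (simp add: even_grp_def)
  have "card ?O \<le> card (even_grp n)"
  proof (rule card_inj_on_le[OF _ _ fin])
    have "inj (y_gen n)" using y(1) parity_grp_subset permutes_inj[OF tree_autsD(1)] by blast
    from fun.inj_map[OF this] show "inj_on ((\<circ>) (y_gen n)) ?O" by (rule inj_on_subset) simp
    show "(\<circ>) (y_gen n) ` ?O \<subseteq> even_grp n"
    proof clarify
      fix \<sigma> assume "\<sigma> \<in> parity_grp n" "root_sign \<sigma> = -1"
      then show "y_gen n \<circ> \<sigma> \<in> even_grp n"
        using parity_grp_comp[of \<sigma> n "y_gen n"] root_sign_comp[of \<sigma> n "y_gen n"] y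
          parity_grp_subset[of n] by (simp add: even_grp_def subset_iff)
    qed
  qed
  moreover have "parity_grp n = even_grp n \<union> ?O"
    using root_sign_cases by (auto simp: even_grp_def)
  then have "card (parity_grp n) \<le> card (even_grp n) + card ?O" by (metis card_Un_le)
  ultimately show ?thesis by linarith
qed

text \<open>The common lower bound for all groups in the theorem: three independent even sections
  under a trivial root permutation.\<close>

definition even_cube :: "nat \<Rightarrow> (word \<Rightarrow> word) set" where
  "even_cube n = {branch n f id | f. \<forall>i\<in>letters. f i \<in> even_grp (n - 1)}"

lemma card_even_cube: "card (even_cube (Suc n)) = card (even_grp n) ^ 3"
proof -
  let ?F = "letters \<rightarrow>\<^sub>E even_grp n"
  have eq: "even_cube (Suc n) = (\<lambda>(f, \<pi>). branch (Suc n) f \<pi>) ` (?F \<times> {id})"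
  proof (intro equalityI subsetI)
    fix \<sigma> assume "\<sigma> \<in> even_cube (Suc n)"
    then obtain f where s: "\<sigma> = branch (Suc n) f id" and f: "\<forall>i\<in>letters. f i \<in> even_grp n"
      by (auto simp: even_cube_def)
    have "\<sigma> = branch (Suc n) (restrict f letters) id"
      unfolding s by (rule branch_cong) auto
    moreover have "restrict f letters \<in> ?F" using f by auto
    ultimately show "\<sigma> \<in> (\<lambda>(f, \<pi>). branch (Suc n) f \<pi>) ` (?F \<times> {id})" by blast
  next
    fix \<sigma> assume "\<sigma> \<in> (\<lambda>(f, \<pi>). branch (Suc n) f \<pi>) ` (?F \<times> {id})"
    then obtain f where "\<sigma> = branch (Suc n) f id" "f \<in> ?F" by auto
    then show "\<sigma> \<in> even_cube (Suc n)"
      unfolding even_cube_def using PiE_mem[of f letters] by fastforce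
  qed
  have "card (even_cube (Suc n)) = card (?F \<times> {id :: nat \<Rightarrow> nat})"
    unfolding eq by (rule card_branch_image[OF even_grp_subset]) (auto simp: permutes_id)
  then show ?thesis by (simp add: card_cartesian_product card_PiE)
qed

lemma even_cube_subset_normal:
  assumes "N \<lhd> L_group (Suc n)" "embed (Suc n) ` L_grp n \<subseteq> N"
  shows "even_cube (Suc n) \<subseteq> N"
  using cube_subset_normal[OF assms] even_grp_subset_L_grp
  by (auto simp: even_cube_def)

section \<open>Logarithms of the orders and the limit\<close>

lemma ln_card_tree_auts: "ln (real (card (tree_auts n))) = (3 ^ n - 1) / 2 * ln 6"
proof (induction n)
  case (Suc n)
  have "card (tree_auts n) > 0"
    using id_in_tree_auts finite_tree_auts card_gt_0_iff by blast
  then have "ln (real (card (tree_auts (Suc n)))) = ln 6 + 3 * ln (real (card (tree_auts n)))"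
    by (simp add: card_tree_auts_Suc ln_mult ln_realpow)
  then show ?case by (simp add: Suc field_simps)
qed (simp add: tree_auts_0)

lemma card_parity_grp_pos: "card (parity_grp n) > 0"
  using id_in_parity_grp finite_parity_grp card_gt_0_iff by blast

text \<open>In P_(n+1) each of the 3^n vertices of level n contributes a free factor 6, and each of
  the (3^n - 1)/2 vertices above them only a factor 3. In the full group every non-leaf vertex
  contributes 6.\<close>

lemma ln_card_parity_grp:
  "ln (real (card (parity_grp (Suc n)))) = 3 ^ n * ln 6 + (3 ^ n - 1) / 2 * ln 3"
proof (induction n)
  case (Suc n)
  have "ln (real (card (parity_grp (Suc (Suc n))))) = ln 3 + 3 * ln (real (card (parity_grp (Suc n))))"
    using card_parity_grp_pos[of "Suc n"] by (simp add: card_parity_grp_Suc ln_mult ln_realpow)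
  then show ?case by (simp add: Suc field_simps)
qed (simp add: card_parity_grp_1)

text \<open>The two bounds on \<open>G\<close> differ in logarithm by at most a constant, which
  vanishes after division by the growing denominator. Indices start at 2, where \<open>H_grp\<close>
  and \<open>K_grp\<close> become meaningful.\<close>

lemma log_density_limit:
  assumes low: "\<And>n. even_cube (Suc (Suc n)) \<subseteq> G (Suc (Suc n))"
    and up: "\<And>n. G (Suc (Suc n)) \<subseteq> parity_grp (Suc (Suc n))"
  shows "log_density G \<longlonglongrightarrow> 1 - 1 / (3 * log 2 6)"
proof -
  \<comment> \<open>\<open>num n\<close> and \<open>den n\<close> are the logarithms of the orders
    of P_(n+2) and Aut(T_(n+2)). The constant \<open>C\<close> is ln 24, with 24 = 3 * 2^3: the
    factor 3 comes from the root permutation and a factor 2 from each coordinate.\<close>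
  define num where "num n = 3 ^ Suc n * ln 6 + (3 ^ Suc n - 1) / 2 * ln (3::real)" for n :: nat
  define den where "den n = (3 ^ Suc (Suc n) - 1) / 2 * ln (6::real)" for n :: nat
  define C :: real where "C = ln 3 + 3 * ln 2"
  have ln36: "ln 3 = ln 6 - ln (2::real)" using ln_mult[of 2 "3::real"] by simp
  have lim: "(\<lambda>n. (num n - c) / den n) \<longlonglongrightarrow> 1 - 1 / (3 * log 2 6)" for c
  proof -
    define q :: "nat \<Rightarrow> real" where "q n = 1 / 3 ^ Suc n" for n
    have q: "q \<longlonglongrightarrow> 0"
      unfolding q_def by (rule LIMSEQ_Suc[OF LIMSEQ_divide_realpow_zero]) simp
    have e: "(num n - c) / den n
      = (ln 6 + ln 3 / 2 - (ln 3 / 2 + c) * q n) / ((3 - q n) / 2 * ln 6)" for n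
    proof -
      have num: "num n - c = 3 ^ Suc n * (ln 6 + ln 3 / 2 - (ln 3 / 2 + c) * q n)"
        by (simp add: num_def q_def field_simps)
      have den: "den n = 3 ^ Suc n * ((3 - q n) / 2 * ln 6)"
        by (simp add: den_def q_def field_simps)
      show ?thesis unfolding num den by (rule mult_divide_mult_cancel_left) simp
    qed
    have "(\<lambda>n. (ln 6 + ln 3 / 2 - (ln 3 / 2 + c) * q n) / ((3 - q n) / 2 * ln 6))
      \<longlonglongrightarrow> (ln 6 + ln 3 / 2 - (ln 3 / 2 + c) * 0) / ((3 - 0) / 2 * ln 6)"
      by (intro tendsto_intros q) auto
    \<comment> \<open>The quotient is 2/3 + ln 3 / (3 ln 6), and ln 3 = ln 6 - ln 2 turns it into
      the claimed form.\<close>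
    moreover have "(ln 6 + ln 3 / 2 - (ln 3 / 2 + c) * 0) / ((3 - 0) / 2 * ln 6) = 1 - 1 / (3 * log 2 6)"
      by (simp add: log_def ln36 field_simps)
    ultimately show ?thesis by (simp add: e)
  qed
  have den_pos: "den n > 0" for n
    using one_less_power[of "3::real" "Suc (Suc n)"] by (simp add: den_def)
  have "log_density G (Suc (Suc n)) = ln (real (card (G (Suc (Suc n))))) / den n" for n
    by (simp add: log_density_def ln_card_tree_auts den_def)
  moreover have "ln (real (card (G (Suc (Suc n))))) \<le> num n"
    and "num n - C \<le> ln (real (card (G (Suc (Suc n)))))" for n
  proof -
    let ?m = "Suc (Suc n)"
    have fin: "finite (G ?m)" using up finite_parity_grp by (rule finite_subset)
    have E: "card (parity_grp (Suc n)) \<le> 2 * card (even_grp (Suc n))"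
      by (rule card_parity_grp_le_even_grp) simp
    then have Epos: "card (even_grp (Suc n)) > 0" using card_parity_grp_pos[of "Suc n"] by simp
    have cube: "card (even_grp (Suc n)) ^ 3 \<le> card (G ?m)"
      using card_mono[OF fin low] by (simp add: card_even_cube)
    then have Gpos: "card (G ?m) > 0" using Epos by (meson less_le_trans zero_less_power)
    have "card (G ?m) \<le> card (parity_grp ?m)" by (rule card_mono[OF finite_parity_grp up])
    then have "ln (real (card (G ?m))) \<le> ln (real (card (parity_grp ?m)))" using Gpos by simp
    then show "ln (real (card (G ?m))) \<le> num n" by (simp only: ln_card_parity_grp num_def)
    have "num n = ln 3 + 3 * ln (real (card (parity_grp (Suc n))))"
      unfolding num_def ln_card_parity_grp by (simp add: field_simps)
    also have "ln (real (card (parity_grp (Suc n)))) \<le> ln (real (2 * card (even_grp (Suc n))))"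
      using E card_parity_grp_pos[of "Suc n"] Epos by (subst ln_le_cancel_iff) (simp_all flip: of_nat_mult)
    also have "\<dots> = ln 2 + ln (real (card (even_grp (Suc n))))"
      using Epos by (simp add: ln_mult)
    finally have "num n - C \<le> ln (real (card (even_grp (Suc n)) ^ 3))"
      using Epos by (simp add: C_def ln_realpow)
    also have "\<dots> \<le> ln (real (card (G ?m)))"
      using cube Epos Gpos by (subst ln_le_cancel_iff) (simp_all flip: of_nat_power)
    finally show "num n - C \<le> ln (real (card (G ?m)))" .
  qed
  ultimately have "(\<lambda>n. log_density G (Suc (Suc n))) \<longlonglongrightarrow> 1 - 1 / (3 * log 2 6)"
    by (intro tendsto_sandwich[OF _ _ lim[of C] lim[of 0]])
      (auto intro!: always_eventually divide_right_mono less_imp_le[OF den_pos])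
  then show ?thesis by (rule LIMSEQ_imp_Suc[OF LIMSEQ_imp_Suc])
qed

text \<open>The integer inequalities 2^19 < 3^12 and 3^17 < 2^27 enclose log_2 3 between 19/12 and
  27/17. The value then lies between 1 - 4/31 and 1 - 17/132.\<close>

lemma log_2_6_bounds: "\<bar>(1 - 1 / (3 * log 2 6)) - 0.871\<bar> < (0.0005 :: real)"
proof -
  have "log 2 6 = 1 + log 2 (3::real)" using log_mult[of 2 3 "2::real"] by simp
  moreover have "19 / 12 < log 2 (3::real)"
  proof -
    have "log 2 (2 ^ 19) < log 2 ((3::real) ^ 12)" by (subst log_less_cancel_iff) simp_all
    then show ?thesis by (simp only: log_nat_power) simp
  qed
  moreover have "log 2 (3::real) < 27 / 17"
  proof -
    have "log 2 ((3::real) ^ 17) < log 2 (2 ^ 27)" by (subst log_less_cancel_iff) simp_all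
    then show ?thesis by (simp only: log_nat_power) simp
  qed
  ultimately have b: "31 / 12 < log 2 (6::real)" "log 2 (6::real) < 44 / 17" by simp_all
  then have "1 / (3 * log 2 6) < 1 / (3 * (31 / 12 :: real))"
    by (intro divide_strict_left_mono) simp_all
  moreover have "1 / (3 * (44 / 17)) < 1 / (3 * log 2 (6::real))"
    using b by (intro divide_strict_left_mono) simp_all
  ultimately show ?thesis by (simp add: abs_if)
qed

subsection \<open>Position of \<open>H\<^sub>n\<close>, \<open>K\<^sub>n\<close> and \<open>M\<^sub>n\<close>\<close>

lemma normal_closure_subset: "N \<lhd> G \<Longrightarrow> S \<subseteq> N \<Longrightarrow> normal_closure G S \<subseteq> N"
  by (auto simp: normal_closure_def)

lemma subset_normal_closure: "S \<subseteq> normal_closure G S"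
  by (auto simp: normal_closure_def)

text \<open>Every normal subgroup entering the intersection contains the cube, and L_(n+1) itself is
  one of them.\<close>

lemma H_grp_bounds:
  "even_cube (Suc n) \<subseteq> H_grp (Suc n)" "H_grp (Suc n) \<subseteq> L_grp (Suc n)"
proof -
  show "even_cube (Suc n) \<subseteq> H_grp (Suc n)"
    unfolding H_grp_def normal_closure_def by (rule Inter_greatest) (simp add: even_cube_subset_normal)
  show "H_grp (Suc n) \<subseteq> L_grp (Suc n)"
    unfolding H_grp_def using embed_in_L_grp
    by (intro normal_closure_subset L_grp_normal_self) simp
qed

lemma K_grp_bounds:
  "H_grp (Suc n) \<subseteq> K_grp (Suc n)" "K_grp (Suc n) \<subseteq> L_grp (Suc n)"
proof -
  have "H_grp (Suc n) \<subseteq> generate (Aut_tree (Suc n)) (H_grp (Suc n) \<union> {z_gen (Suc n)})"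
    by (blast intro: generate.incl)
  then show "H_grp (Suc n) \<subseteq> K_grp (Suc n)"
    unfolding K_grp_def using subset_normal_closure by (rule subset_trans)
  have "H_grp (Suc n) \<union> {z_gen (Suc n)} \<subseteq> L_grp (Suc n)"
    using H_grp_bounds(2) z_gen_in_L_grp by blast
  then show "K_grp (Suc n) \<subseteq> L_grp (Suc n)"
    unfolding K_grp_def
    by (intro normal_closure_subset L_grp_normal_self
        group.generate_subgroup_incl[OF group_Aut_tree _ subgroup_L_grp])
qed

lemma L_grp_subset_parity_grp: "L_grp n \<subseteq> parity_grp n"
  using L_grp_subset_even_grp by (auto simp: even_grp_def)

text \<open>M has the generators of L together with \<open>y_gen\<close>, the only odd generator,
  which still lies in the parity group.\<close>

lemma M_grp_bounds:
  "L_grp (Suc (Suc n)) \<subseteq> M_grp (Suc (Suc n))" "M_grp (Suc (Suc n)) \<subseteq> parity_grp (Suc (Suc n))"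
proof -
  show "L_grp (Suc (Suc n)) \<subseteq> M_grp (Suc (Suc n))"
    unfolding L_grp.simps M_grp.simps
    by (rule group.mono_generate[OF group_Aut_tree]) blast
  have "{x_gen (Suc (Suc n)), y_gen (Suc (Suc n)), z_gen (Suc (Suc n))}
      \<union> embed (Suc (Suc n)) ` L_grp (Suc n) \<subseteq> parity_grp (Suc (Suc n))"
    using L_gens_subset[OF L_grp_subset_even_grp, of "Suc n"] y_gen_in_parity_grp[of "Suc (Suc n)"]
    unfolding even_grp_def by blast
  then show "M_grp (Suc (Suc n)) \<subseteq> parity_grp (Suc (Suc n))"
    unfolding M_grp.simps
    by (rule group.generate_subgroup_incl[OF group_Aut_tree _ subgroup_parity_grp])
qed

theorem theorem3p23:
  shows "log_density M_grp \<longlonglongrightarrow> 1 - 1 / (3 * log 2 6)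
    \<and> \<bar>(1 - 1 / (3 * log 2 6)) - 0.871\<bar> < 0.0005
    \<and> log_density H_grp \<longlonglongrightarrow> 1 - 1 / (3 * log 2 6)
    \<and> log_density K_grp \<longlonglongrightarrow> 1 - 1 / (3 * log 2 6)
    \<and> log_density (\<lambda>n. generate (Aut_tree n) (K_grp n \<union> {y_gen n})) \<longlonglongrightarrow> 1 - 1 / (3 * log 2 6)"
proof (intro conjI log_density_limit log_2_6_bounds)
  fix n
  let ?m = "Suc (Suc n)"
  \<comment> \<open>These give the chain \<open>even_cube\<close> \<subseteq> H \<subseteq> K
    \<subseteq> L \<subseteq> M \<subseteq> \<open>parity_grp\<close>. The group generated by K and
    y fits the same bounds, since y lies in \<open>parity_grp\<close>.\<close>
  note cubes = H_grp_bounds[of "Suc n"] K_grp_bounds[of "Suc n"] M_grp_bounds[of n]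
    L_grp_subset_parity_grp[of ?m]
  show "even_cube ?m \<subseteq> M_grp ?m" "M_grp ?m \<subseteq> parity_grp ?m"
    "even_cube ?m \<subseteq> H_grp ?m" "H_grp ?m \<subseteq> parity_grp ?m"
    "even_cube ?m \<subseteq> K_grp ?m" "K_grp ?m \<subseteq> parity_grp ?m"
    using cubes by (blast dest: subsetD)+
  show "even_cube ?m \<subseteq> generate (Aut_tree ?m) (K_grp ?m \<union> {y_gen ?m})"
    using cubes by (blast intro: generate.incl)
  show "generate (Aut_tree ?m) (K_grp ?m \<union> {y_gen ?m}) \<subseteq> parity_grp ?m"
    using cubes y_gen_in_parity_grp[of ?m]
    by (intro group.generate_subgroup_incl[OF group_Aut_tree _ subgroup_parity_grp]) blast
qed

end
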